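(* Let $\phi := \psi\ \mathrm{WINDOW}\ w$ be a bounded and windowed core-CEPL expression. Then the unrolled RMA (URMA) $A$ constructed from $\phi$ is output-agnostic determinizable, i.e. there exists an output-agnostic deterministic RMA $A^D$ such that, for every stream $S$, there exists an accepting run of $A$ over $S$ if and only if there exists an accepting run of $A^D$ over $S$.
   Context: **Events and streams.** Fix a schema $\mathcal{R}$, a finite set of relation names (event types). $\mathit{tuples}(\mathcal{R})$ is the set of all events (tuples); each event $t$ has a type $\mathit{type}(t)\in\mathcal{R}$ and attribute values. A stream $S=t_0t_1t_2\cdots$ is a (finite or infinite) sequence of events. Fix a set of predicates (relations of any finite arity) over $\mathit{tuples}(\mathcal{R})$ containing the always-true unary predicate $\mathrm{TRUE}$ and the unary predicates $\mathit{type}(z)=R$ for $R\in\mathcal{R}$. A selection formula $f(x_1,\dots,x_n)$ is a Boolean combination of atomic formulas over these predicates; $\mathit{var}(f)$ is its set of variables. **Core-CEPL.** Expressions are given by the grammar $\phi := R\ \mathrm{AS}\ x \mid \phi\ \mathrm{FILTER}\ f \mid \phi\ \mathrm{OR}\ \phi \mid \phi;\phi \mid \phi^{+}$, where $R\in\mathcal R$, $x$ is a variable, $f$ a selection formula. $\mathit{var}(\phi)$ is the set of all variables occurring in $\phi$ (including in filters). $\mathit{bound}(R\ \mathrm{AS}\ x)=\{x\}$, $\mathit{bound}(\psi\ \mathrm{FILTER}\ f)=\mathit{bound}(\psi)$, $\mathit{bound}(\phi_1\ \mathrm{OR}\ \phi_2)=\mathit{bound}(\phi_1)\cap\mathit{bound}(\phi_2)$,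 $\mathit{bound}(\phi_1;\phi_2)=\mathit{bound}(\phi_1)\cup\mathit{bound}(\phi_2)$, $\mathit{bound}(\psi^+)=\emptyset$. $\phi$ is well-formed if for every sub-expression $\rho\ \mathrm{FILTER}\ f$ and every $x\in\mathit{var}(f)$ there is a sub-expression $\psi$ of $\phi$ having $\rho$ as a sub-expression with $x\in\mathit{bound}(\psi)$. $\phi$ is bounded if it is well-formed and: $\phi=R\ \mathrm{AS}\ x$; or $\phi=\psi\ \mathrm{FILTER}\ f$ with $\psi$ bounded and $\mathit{var}(f)\subseteq\mathit{bound}(\psi)$; or $\phi$ is $\phi_1\ \mathrm{OR}\ \phi_2$, $\phi_1;\phi_2$ or $\psi^+$ with all its sub-expressions bounded and, in the case $\phi_1;\phi_2$, $\mathit{var}(\phi_1)\cap\mathit{var}(\phi_2)=\emptyset$. A bounded and windowed core-CEPL expression is $\psi\ \mathrm{WINDOW}\ w$ with $\psi$ a bounded core-CEPL expression and $w\in\mathbb{N}$, $w>0$ (its matches are the matches $M$ of $\psi$ with $\max(M)-\min(M)<w$). **RMA.** A Register Match Automaton is a tuple $(Q,Q^s,Q^f,RG,\Delta)$: $Q$ a finite set of states, $Q^s\subseteq Q$ start states, $Q^f\subseteq Q$ final states, $RG$ a finite set of registers, $\Delta$ a finite set of transitions. A transition is either an $\epsilon$-transition from a state $q$ to a state $p$, or a tuple $(q,f,rs)\to(p,R,o)$ with $q,p\in Q$, $f$ a selection formula, $rs=(r_1,\dots,r_n)$ the register selection with $r_j\in RG\cup\{\sim\}$, $R\subseteq RG$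 the write registers, and output $o\in\{\circ,\bullet\}$. Register contents are a function $\gamma$ on $RG\cup\{\sim\}$, with $\gamma(\sim)$ the current event being consumed; $\sharp$ denotes an empty register. A non-$\epsilon$ transition applies on consuming an event if $f(\gamma(r_1),\dots,\gamma(r_n))$ is true; an $\epsilon$-transition applies without consuming an event. Standing structural requirement: for every state $q$ and register $r\in RG$ in the register selection of a transition leaving $q$, every trail to $q$ (sequence of successive transitions from a start state to $q$ without state re-visits) contains a transition with $r$ among its write registers (so transitions from a start state use only $\sim$). A configuration is $[i,q,\gamma]$ ($i$ = index of next event). $[i',q',\gamma']$ is a successor of $[i,q,\gamma]$ via an applicable transition $\delta$ from $q$ to $q'$ if: for $\delta$ an $\epsilon$-transition, $i'=i$ and $\gamma'=\gamma$; otherwise $i'=i+1$, $\gamma'(r)=t_i$ for $r\in R$ and $\gamma'(r)=\gamma(r)$ for $r\in RG\setminus R$. A run over $S$ is a finite sequence of successor configurations starting at index $0$, in a start state, with all registers empty. A run is accepting if its last state is in $Q^f$ and the output of its last event-consuming transition is $\bullet$. **Output-agnostic determinism.** An RMA is output-agnostic deterministic if it has a single start state, no $\epsilon$-transitions, and for any two distinct transitions $(q,f_1,rs_1)\to(p_1,R_1,o_1)$ and $(q,f_2,rs_2)\to(p_2,R_2,o_2)$ from the same state, regardless of outputs, $f_1$ and $f_2$ (applied to their register selections) are mutually exclusive, i.e. at most one can evaluate to true. **Construction of the URMA from $\psi\ \mathrm{WINDOW}\ w$.** *Step 1: RMA for $\psi$*, defined recursively, with some transitions labelled by variables and each register associated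 with a variable; each automaton has one start and one final state. - $R\ \mathrm{AS}\ x$: states $q^s$ (start), $q^f$ (final); transitions $(q^s,\mathrm{TRUE},\sim)\to(q^s,\emptyset,\circ)$ (unlabelled) and $(q^s,\mathit{type}(z)=R,\sim)\to(q^f,\emptyset,\bullet)$, labelled $x$. - $\phi_1\ \mathrm{OR}\ \phi_2$: the union of the two automata with a new start state having $\epsilon$-transitions to both start states and a new final state receiving $\epsilon$-transitions from both final states (registers associated with the same variable are identified). - $\phi_1;\phi_2$: an $\epsilon$-transition from the final state of the first automaton to the start state of the second; start state of the first, final state of the second. - $\psi_1^+$: add an $\epsilon$-transition from the final state to the start state. - $\psi_1\ \mathrm{FILTER}\ f(x_1,\dots,x_n)$: in the automaton of $\psi_1$, for each transition $\delta$ labelled by some $x_j\in\mathit{var}(f)$ such that every other variable of $f$ labels a transition on every trail to the source of $\delta$, conjoin $f$ to the formula of $\delta$, where the argument $x_j$ is read from $\sim$ and each other argument $x_k$ from the register associated with $x_k$; if there is no such register, create one and make all transitions labelled $x_k$ write to it (and only to it). *Step 2:* eliminate $\epsilon$-transitions in the standard way, giving an $\epsilon$-free RMA $A^\psi$ with start state $q^s$, each transition writing to at most one register. *Step 3: unrolling.* Build a tree: the root is a copy of $q^s$; for $k=1,\dots,w$, for every tree state $q$ at depth $k-1$, a copy of a state $q_c$ of $A^\psi$, and every transition $\delta$ of $A^\psi$ leaving $q_c$, add a new state (a copy of the target of $\delta$, final iff that target is final) and a transition from $q$ to it with the same formula and output as $\delta$; if $\delta$ writes to a register $r$, the new transition writes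 to a fresh register, called a copy of $r$; the register selection is that of $\delta$ with each register $r$ replaced by the copy of $r$ written last on the path from the root to $q$ ($\sim$ is kept). The root is the start state (final iff $q^s$ is final). *Step 4:* add the self-loop $(q,\mathrm{TRUE},\sim)\to(q,\emptyset,\circ)$ on the root $q$. The result is the URMA constructed from $\psi\ \mathrm{WINDOW}\ w$.
   Formalization: In the FILTER step, all transitions labelled x_k write to the register of x_k whenever the filter reads it, even if that register already exists; literally, a register coming from only one disjunct of an OR would be read unwritten in the other, leaving the unrolling undefined. *)

theory Defs
  imports Main
begin

section \<open>Events, predicates, selection formulas, streams\<close>

text \<open>
  The type \<open>'e\<close> is the set of all events over the schema, the finite type \<open>'r\<close> is the schema and
  \<open>type_of :: 'e \<Rightarrow> 'r\<close> gives the type of an event. Attribute values are only ever accessed through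
  predicates. A predicate is an arity together with a set of event lists of that length.
\<close>

type_synonym 'e predicate = "nat \<times> 'e list set"

definition true_pred :: "'e predicate" where
  "true_pred = (1, {[t] | t. True})"

definition type_pred :: "('e \<Rightarrow> 'r) \<Rightarrow> 'r \<Rightarrow> 'e predicate" where
  "type_pred type_of R = (1, {[t] | t. type_of t = R})"

definition predicate_set :: "('e \<Rightarrow> 'r) \<Rightarrow> 'e predicate set \<Rightarrow> bool" where
  "predicate_set type_of preds \<longleftrightarrow>
     (\<forall>P\<in>preds. \<forall>ts\<in>snd P. length ts = fst P) \<and>
     true_pred \<in> preds \<and> (\<forall>R. type_pred type_of R \<in> preds)"

datatype (dead 'e, fvar: 'x) formula =
    Atom "'e predicate" "'x list"
  | Neg "('e, 'x) formula"
  | Conj "('e, 'x) formula" "('e, 'x) formula"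
  | Disj "('e, 'x) formula" "('e, 'x) formula"

primrec holds :: "('x \<Rightarrow> 'e) \<Rightarrow> ('e, 'x) formula \<Rightarrow> bool" where
  "holds \<sigma> (Atom P xs) \<longleftrightarrow> map \<sigma> xs \<in> snd P"
| "holds \<sigma> (Neg f) \<longleftrightarrow> \<not> holds \<sigma> f"
| "holds \<sigma> (Conj f g) \<longleftrightarrow> holds \<sigma> f \<and> holds \<sigma> g"
| "holds \<sigma> (Disj f g) \<longleftrightarrow> holds \<sigma> f \<or> holds \<sigma> g"

primrec selection_formula :: "'e predicate set \<Rightarrow> ('e, 'x) formula \<Rightarrow> bool" where
  "selection_formula preds (Atom P xs) \<longleftrightarrow> P \<in> preds \<and> length xs = fst P"
| "selection_formula preds (Neg f) \<longleftrightarrow> selection_formula preds f"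
| "selection_formula preds (Conj f g) \<longleftrightarrow> selection_formula preds f \<and> selection_formula preds g"
| "selection_formula preds (Disj f g) \<longleftrightarrow> selection_formula preds f \<and> selection_formula preds g"

datatype 'e event_stream = Finite "'e list" | Infinite "nat \<Rightarrow> 'e"

fun event_at :: "'e event_stream \<Rightarrow> nat \<Rightarrow> 'e option" where
  "event_at (Finite ts) i = (if i < length ts then Some (ts ! i) else None)"
| "event_at (Infinite s) i = Some (s i)"


section \<open>Core-CEPL\<close>

datatype ('r, 'e, 'v) cepl =
    As 'r 'v
  | Filter "('r, 'e, 'v) cepl" "('e, 'v) formula"
  | Or "('r, 'e, 'v) cepl" "('r, 'e, 'v) cepl"
  | Seq "('r, 'e, 'v) cepl" "('r, 'e, 'v) cepl"
  | Plus "('r, 'e, 'v) cepl"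

datatype ('r, 'e, 'v) windowed_cepl = Window "('r, 'e, 'v) cepl" nat  (infix "WINDOW" 60)

primrec core_cepl :: "'e predicate set \<Rightarrow> ('r, 'e, 'v) cepl \<Rightarrow> bool" where
  "core_cepl preds (As R x) \<longleftrightarrow> True"
| "core_cepl preds (Filter \<psi> f) \<longleftrightarrow> core_cepl preds \<psi> \<and> selection_formula preds f"
| "core_cepl preds (Or \<phi>1 \<phi>2) \<longleftrightarrow> core_cepl preds \<phi>1 \<and> core_cepl preds \<phi>2"
| "core_cepl preds (Seq \<phi>1 \<phi>2) \<longleftrightarrow> core_cepl preds \<phi>1 \<and> core_cepl preds \<phi>2"
| "core_cepl preds (Plus \<psi>) \<longleftrightarrow> core_cepl preds \<psi>"

primrec cvar :: "('r, 'e, 'v) cepl \<Rightarrow> 'v set" where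
  "cvar (As R x) = {x}"
| "cvar (Filter \<psi> f) = cvar \<psi> \<union> fvar f"
| "cvar (Or \<phi>1 \<phi>2) = cvar \<phi>1 \<union> cvar \<phi>2"
| "cvar (Seq \<phi>1 \<phi>2) = cvar \<phi>1 \<union> cvar \<phi>2"
| "cvar (Plus \<psi>) = cvar \<psi>"

primrec bound :: "('r, 'e, 'v) cepl \<Rightarrow> 'v set" where
  "bound (As R x) = {x}"
| "bound (Filter \<psi> f) = bound \<psi>"
| "bound (Or \<phi>1 \<phi>2) = bound \<phi>1 \<inter> bound \<phi>2"
| "bound (Seq \<phi>1 \<phi>2) = bound \<phi>1 \<union> bound \<phi>2"
| "bound (Plus \<psi>) = {}"

primrec subexprs :: "('r, 'e, 'v) cepl \<Rightarrow> ('r, 'e, 'v) cepl set" where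
  "subexprs (As R x) = {As R x}"
| "subexprs (Filter \<psi> f) = insert (Filter \<psi> f) (subexprs \<psi>)"
| "subexprs (Or \<phi>1 \<phi>2) = insert (Or \<phi>1 \<phi>2) (subexprs \<phi>1 \<union> subexprs \<phi>2)"
| "subexprs (Seq \<phi>1 \<phi>2) = insert (Seq \<phi>1 \<phi>2) (subexprs \<phi>1 \<union> subexprs \<phi>2)"
| "subexprs (Plus \<psi>) = insert (Plus \<psi>) (subexprs \<psi>)"

definition well_formed :: "('r, 'e, 'v) cepl \<Rightarrow> bool" where
  "well_formed \<phi> \<longleftrightarrow>
     (\<forall>\<rho> f. Filter \<rho> f \<in> subexprs \<phi> \<longrightarrow>
        (\<forall>x\<in>fvar f. \<exists>\<psi>\<in>subexprs \<phi>. \<rho> \<in> subexprs \<psi> \<and> x \<in> bound \<psi>))"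

primrec bounded_cepl :: "('r, 'e, 'v) cepl \<Rightarrow> bool" where
  "bounded_cepl (As R x) \<longleftrightarrow> well_formed (As R x :: ('r, 'e, 'v) cepl)"
| "bounded_cepl (Filter \<psi> f) \<longleftrightarrow> well_formed (Filter \<psi> f) \<and> bounded_cepl \<psi> \<and> fvar f \<subseteq> bound \<psi>"
| "bounded_cepl (Or \<phi>1 \<phi>2) \<longleftrightarrow> well_formed (Or \<phi>1 \<phi>2) \<and> bounded_cepl \<phi>1 \<and> bounded_cepl \<phi>2"
| "bounded_cepl (Seq \<phi>1 \<phi>2) \<longleftrightarrow>
     well_formed (Seq \<phi>1 \<phi>2) \<and> bounded_cepl \<phi>1 \<and> bounded_cepl \<phi>2 \<and> cvar \<phi>1 \<inter> cvar \<phi>2 = {}"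
| "bounded_cepl (Plus \<psi>) \<longleftrightarrow> well_formed (Plus \<psi>) \<and> bounded_cepl \<psi>"

primrec bounded_windowed :: "'e predicate set \<Rightarrow> ('r, 'e, 'v) windowed_cepl \<Rightarrow> bool" where
  "bounded_windowed preds (\<psi> WINDOW w) \<longleftrightarrow> core_cepl preds \<psi> \<and> bounded_cepl \<psi> \<and> w > 0"


section \<open>Register match automata\<close>

datatype mark_output = Skip | Mark

text \<open>
  \<open>Read q f rs p R o\<close> is the transition \<open>(q, f, rs) \<rightarrow> (p, R, o)\<close>. The variables of \<open>f\<close> are the
  positions \<open>0, \<dots>, n - 1\<close> of the register selection \<open>rs = (r\<^sub>0, \<dots>, r\<^sub>n\<^sub>-\<^sub>1)\<close>, in which \<open>None\<close> stands for
  the pseudo-register \<open>\<sim>\<close>. \<open>Skip\<close> is the output \<open>\<circ>\<close> and \<open>Mark\<close> is \<open>\<bullet>\<close>.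
\<close>

datatype ('q, dead 'g, dead 'e) transition =
    is_Eps: Eps (src: 'q) (tgt: 'q)
  | is_Read: Read (src: 'q) (fml: "('e, nat) formula") (sel: "'g option list")
           (tgt: 'q) (writes: "'g set") (out: mark_output)
where
  "sel (Eps q p) = []"
| "writes (Eps q p) = {}"

record ('q, 'g, 'e) rma =
  states :: "'q set"
  starts :: "'q set"
  finals :: "'q set"
  regs :: "'g set"
  trans :: "('q, 'g, 'e) transition set"

fun path :: "'q \<Rightarrow> ('q, 'g, 'e) transition list \<Rightarrow> 'q \<Rightarrow> bool" where
  "path p [] q \<longleftrightarrow> p = q"
| "path p (\<delta> # \<delta>s) q \<longleftrightarrow> src \<delta> = p \<and> path (tgt \<delta>) \<delta>s q"

definition trail :: "('q, 'g, 'e) rma \<Rightarrow> ('q, 'g, 'e) transition list \<Rightarrow> 'q \<Rightarrow> bool" where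
  "trail A \<delta>s q \<longleftrightarrow>
     (\<exists>q0\<in>starts A. set \<delta>s \<subseteq> trans A \<and> path q0 \<delta>s q \<and> distinct (q0 # map tgt \<delta>s))"

definition is_rma :: "'e predicate set \<Rightarrow> ('q, 'g, 'e) rma \<Rightarrow> bool" where
  "is_rma preds A \<longleftrightarrow>
     finite (states A) \<and> starts A \<subseteq> states A \<and> finals A \<subseteq> states A \<and>
     finite (regs A) \<and> finite (trans A) \<and>
     (\<forall>\<delta>\<in>trans A. src \<delta> \<in> states A \<and> tgt \<delta> \<in> states A) \<and>
     (\<forall>q f rs p R z. Read q f rs p R z \<in> trans A \<longrightarrow>
        selection_formula preds f \<and> fvar f = {..<length rs} \<and>
        set rs \<subseteq> insert None (Some ` regs A) \<and> R \<subseteq> regs A) \<and>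
     (\<forall>\<delta>\<in>trans A. \<forall>r. Some r \<in> set (sel \<delta>) \<longrightarrow>
        (\<forall>\<delta>s. trail A \<delta>s (src \<delta>) \<longrightarrow> (\<exists>\<epsilon>\<in>set \<delta>s. r \<in> writes \<epsilon>)))"

text \<open>
  Register contents are given by \<open>\<gamma>\<close>, where \<open>None\<close> is an empty register; \<open>contents \<gamma> t\<close> extends \<open>\<gamma>\<close>
  to \<open>\<sim>\<close>, which holds the event \<open>t\<close> being consumed. A formula is only true if all the registers
  it is applied to are nonempty.
\<close>

primrec contents :: "('g \<Rightarrow> 'e option) \<Rightarrow> 'e \<Rightarrow> 'g option \<Rightarrow> 'e option" where
  "contents \<gamma> t None = Some t"
| "contents \<gamma> t (Some r) = \<gamma> r"

definition sat :: "('g \<Rightarrow> 'e option) \<Rightarrow> 'e \<Rightarrow> ('e, nat) formula \<Rightarrow> 'g option list \<Rightarrow> bool" where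
  "sat \<gamma> t f rs \<longleftrightarrow> (\<exists>us. map (contents \<gamma> t) rs = map Some us \<and> holds (\<lambda>j. us ! j) f)"

type_synonym ('q, 'g, 'e) config = "nat \<times> 'q \<times> ('g \<Rightarrow> 'e option)"

inductive successor ::
  "('q, 'g, 'e) rma \<Rightarrow> 'e event_stream \<Rightarrow>
   ('q, 'g, 'e) config \<Rightarrow> ('q, 'g, 'e) transition \<Rightarrow> ('q, 'g, 'e) config \<Rightarrow> bool"
  for A S where
  eps: "Eps q p \<in> trans A \<Longrightarrow> successor A S (i, q, \<gamma>) (Eps q p) (i, p, \<gamma>)"
| read: "Read q f rs p R z \<in> trans A \<Longrightarrow> event_at S i = Some t \<Longrightarrow> sat \<gamma> t f rs \<Longrightarrow>
    successor A S (i, q, \<gamma>) (Read q f rs p R z)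
      (Suc i, p, \<lambda>r. if r \<in> R then Some t else \<gamma> r)"

text \<open>
  Besides its configurations, a run records the transitions taken, since these carry the outputs.
\<close>

definition run ::
  "('q, 'g, 'e) rma \<Rightarrow> 'e event_stream \<Rightarrow>
   ('q, 'g, 'e) config list \<Rightarrow> ('q, 'g, 'e) transition list \<Rightarrow> bool" where
  "run A S cs \<delta>s \<longleftrightarrow>
     length cs = Suc (length \<delta>s) \<and>
     (\<exists>q\<in>starts A. cs ! 0 = (0, q, \<lambda>_. None)) \<and>
     (\<forall>k<length \<delta>s. successor A S (cs ! k) (\<delta>s ! k) (cs ! Suc k))"

definition accepting_run ::
  "('q, 'g, 'e) rma \<Rightarrow> 'e event_stream \<Rightarrow>
   ('q, 'g, 'e) config list \<Rightarrow> ('q, 'g, 'e) transition list \<Rightarrow> bool" where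
  "accepting_run A S cs \<delta>s \<longleftrightarrow>
     run A S cs \<delta>s \<and> fst (snd (last cs)) \<in> finals A \<and>
     (let \<epsilon>s = filter is_Read \<delta>s in \<epsilon>s \<noteq> [] \<and> out (last \<epsilon>s) = Mark)"

definition output_agnostic_deterministic :: "('q, 'g, 'e) rma \<Rightarrow> bool" where
  "output_agnostic_deterministic A \<longleftrightarrow>
     (\<exists>q. starts A = {q}) \<and>
     (\<forall>\<delta>\<in>trans A. is_Read \<delta>) \<and>
     (\<forall>\<delta>1\<in>trans A. \<forall>\<delta>2\<in>trans A. \<delta>1 \<noteq> \<delta>2 \<and> src \<delta>1 = src \<delta>2 \<longrightarrow>
        (\<forall>\<gamma> t. \<not> (sat \<gamma> t (fml \<delta>1) (sel \<delta>1) \<and> sat \<gamma> t (fml \<delta>2) (sel \<delta>2))))"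

text \<open>
  As an RMA has finitely many states and registers, natural numbers are general enough to name
  those of the deterministic automaton.
\<close>

definition output_agnostic_determinizable ::
  "'e predicate set \<Rightarrow> ('q, 'g, 'e) rma \<Rightarrow> bool" where
  "output_agnostic_determinizable preds A \<longleftrightarrow>
     (\<exists>AD :: (nat, nat, 'e) rma.
        is_rma preds AD \<and> output_agnostic_deterministic AD \<and>
        (\<forall>S. (\<exists>cs \<delta>s. accepting_run A S cs \<delta>s) \<longleftrightarrow> (\<exists>cs \<delta>s. accepting_run AD S cs \<delta>s)))"


section \<open>From core-CEPL to labelled RMA\<close>

text \<open>
  States are named by lists of numbers, so that prefixing by \<open>0\<close> and \<open>1\<close> makes two automata disjoint.
  The register associated with a variable is named by that variable, so taking unions identifies
  the registers associated with the same variable. A transition is paired with its label, if any.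
\<close>

type_synonym sname = "nat list"

type_synonym ('v, 'e) ltransition = "'v option \<times> (sname, 'v, 'e) transition"

record ('v, 'e) labelled_rma =
  lstates :: "sname set"
  lstart :: sname
  lfinal :: sname
  lregs :: "'v set"
  ltrans :: "('v, 'e) ltransition set"

definition underlying :: "('v, 'e) labelled_rma \<Rightarrow> (sname, 'v, 'e) rma" where
  "underlying A = \<lparr>states = lstates A, starts = {lstart A}, finals = {lfinal A}, regs = lregs A,
     trans = snd ` ltrans A\<rparr>"

definition tag :: "nat \<Rightarrow> ('v, 'e) labelled_rma \<Rightarrow> ('v, 'e) labelled_rma" where
  "tag n A = \<lparr>lstates = Cons n ` lstates A, lstart = n # lstart A, lfinal = n # lfinal A,
     lregs = lregs A, ltrans = map_prod id (map_transition (Cons n)) ` ltrans A\<rparr>"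

definition true_fml :: "('e, nat) formula" where
  "true_fml = Atom true_pred [0]"

definition as_rma :: "('e \<Rightarrow> 'r) \<Rightarrow> 'r \<Rightarrow> 'v \<Rightarrow> ('v, 'e) labelled_rma" where
  "as_rma type_of R x = \<lparr>lstates = {[0], [1]}, lstart = [0], lfinal = [1], lregs = {},
     ltrans = {(None, Read [0] true_fml [None] [0] {} Skip),
               (Some x, Read [0] (Atom (type_pred type_of R) [0]) [None] [1] {} Mark)}\<rparr>"

definition or_rma ::
  "('v, 'e) labelled_rma \<Rightarrow> ('v, 'e) labelled_rma \<Rightarrow> ('v, 'e) labelled_rma" where
  "or_rma A1 A2 = (let B1 = tag 0 A1; B2 = tag 1 A2 in
     \<lparr>lstates = {[2], [3]} \<union> lstates B1 \<union> lstates B2, lstart = [2], lfinal = [3],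
      lregs = lregs B1 \<union> lregs B2,
      ltrans = ltrans B1 \<union> ltrans B2 \<union>
        {(None, Eps [2] (lstart B1)), (None, Eps [2] (lstart B2)),
         (None, Eps (lfinal B1) [3]), (None, Eps (lfinal B2) [3])}\<rparr>)"

definition seq_rma ::
  "('v, 'e) labelled_rma \<Rightarrow> ('v, 'e) labelled_rma \<Rightarrow> ('v, 'e) labelled_rma" where
  "seq_rma A1 A2 = (let B1 = tag 0 A1; B2 = tag 1 A2 in
     \<lparr>lstates = lstates B1 \<union> lstates B2, lstart = lstart B1, lfinal = lfinal B2,
      lregs = lregs B1 \<union> lregs B2,
      ltrans = ltrans B1 \<union> ltrans B2 \<union> {(None, Eps (lfinal B1) (lstart B2))}\<rparr>)"

definition plus_rma :: "('v, 'e) labelled_rma \<Rightarrow> ('v, 'e) labelled_rma" where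
  "plus_rma A = A\<lparr>ltrans := insert (None, Eps (lfinal A) (lstart A)) (ltrans A)\<rparr>"

definition filter_applies ::
  "('e, 'v) formula \<Rightarrow> ('v, 'e) labelled_rma \<Rightarrow> ('v, 'e) ltransition \<Rightarrow> 'v \<Rightarrow> bool" where
  "filter_applies f A l x \<longleftrightarrow> l \<in> ltrans A \<and> fst l = Some x \<and> x \<in> fvar f \<and>
     (\<forall>y\<in>fvar f - {x}. \<forall>\<delta>s. trail (underlying A) \<delta>s (src (snd l)) \<longrightarrow>
        (\<exists>\<epsilon>\<in>set \<delta>s. (Some y, \<epsilon>) \<in> ltrans A))"

text \<open>The variables whose registers are read once \<open>f\<close> has been conjoined.\<close>

definition filter_regs :: "('e, 'v) formula \<Rightarrow> ('v, 'e) labelled_rma \<Rightarrow> 'v set" where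
  "filter_regs f A = {y. \<exists>l x. filter_applies f A l x \<and> y \<in> fvar f - {x}}"

primrec var_occs :: "('e, 'x) formula \<Rightarrow> 'x list" where
  "var_occs (Atom P xs) = xs"
| "var_occs (Neg f) = var_occs f"
| "var_occs (Conj f g) = var_occs f @ var_occs g"
| "var_occs (Disj f g) = var_occs f @ var_occs g"

definition position :: "'a list \<Rightarrow> 'a \<Rightarrow> nat" where
  "position xs x = length (takeWhile (\<lambda>y. y \<noteq> x) xs)"

text \<open>
  Conjoining \<open>f(x\<^sub>1, \<dots>, x\<^sub>n)\<close> to the transition formula \<open>g\<close> with selection \<open>rs\<close>: the arguments of \<open>f\<close> are
  appended to \<open>rs\<close>, so its variables are renamed to the positions from \<open>length rs\<close> on.
\<close>

primrec filter_trans ::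
  "('e, 'v) formula \<Rightarrow> ('v, 'e) labelled_rma \<Rightarrow> 'v \<Rightarrow> (sname, 'v, 'e) transition \<Rightarrow>
   (sname, 'v, 'e) transition" where
  "filter_trans f A x (Eps q p) = Eps q p"
| "filter_trans f A x (Read q g rs p R z) =
     (let R' = (if x \<in> filter_regs f A then {x} else R) in
      if filter_applies f A (Some x, Read q g rs p R z) x then
        let xs = remdups (var_occs f) in
        Read q (Conj g (map_formula (\<lambda>y. length rs + position xs y) f))
          (rs @ map (\<lambda>y. if y = x then None else Some y) xs) p R' z
      else Read q g rs p R' z)"

text \<open>
  All transitions labelled \<open>y\<close> are made to write the register of \<open>y\<close> even if that register exists
  already: in a disjunction it may stem from one disjunct only, and the identified register has
  to be written in both. If all of them write it already, nothing changes.
\<close>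

definition filter_rma ::
  "('e, 'v) formula \<Rightarrow> ('v, 'e) labelled_rma \<Rightarrow> ('v, 'e) labelled_rma" where
  "filter_rma f A = A\<lparr>lregs := lregs A \<union> filter_regs f A,
     ltrans := (\<lambda>(lab, \<delta>). (lab, case lab of None \<Rightarrow> \<delta> | Some x \<Rightarrow> filter_trans f A x \<delta>)) ` ltrans A\<rparr>"

primrec rma_of :: "('e \<Rightarrow> 'r) \<Rightarrow> ('r, 'e, 'v) cepl \<Rightarrow> ('v, 'e) labelled_rma" where
  "rma_of type_of (As R x) = as_rma type_of R x"
| "rma_of type_of (Or \<phi>1 \<phi>2) = or_rma (rma_of type_of \<phi>1) (rma_of type_of \<phi>2)"
| "rma_of type_of (Seq \<phi>1 \<phi>2) = seq_rma (rma_of type_of \<phi>1) (rma_of type_of \<phi>2)"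
| "rma_of type_of (Plus \<psi>) = plus_rma (rma_of type_of \<psi>)"
| "rma_of type_of (Filter \<psi> f) = filter_rma f (rma_of type_of \<psi>)"


section \<open>Elimination of \<open>\<epsilon>\<close>-transitions and unrolling\<close>

definition eps_closure :: "('q, 'g, 'e) rma \<Rightarrow> ('q \<times> 'q) set" where
  "eps_closure A = {(q, p). Eps q p \<in> trans A}\<^sup>*"

definition eps_free :: "('q, 'g, 'e) rma \<Rightarrow> ('q, 'g, 'e) rma" where
  "eps_free A = A\<lparr>
     finals := {q \<in> states A. \<exists>q'\<in>finals A. (q, q') \<in> eps_closure A},
     trans := {Read q f rs p R z | q f rs p R z. q \<in> states A \<and>
       (\<exists>q'. (q, q') \<in> eps_closure A \<and> Read q' f rs p R z \<in> trans A)}\<rparr>"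

text \<open>
  A state of the tree is named by the transitions on the path from the root to it, the most recent
  one first, and the copy of register \<open>r\<close> written on entering the tree state \<open>\<pi>\<close> is \<open>(\<pi>, r)\<close>.
\<close>

type_synonym ('q, 'g, 'e) node = "('q, 'g, 'e) transition list"

fun copied_state :: "'q \<Rightarrow> ('q, 'g, 'e) node \<Rightarrow> 'q" where
  "copied_state qs [] = qs"
| "copied_state qs (\<delta> # \<pi>) = tgt \<delta>"

inductive_set nodes :: "('q, 'g, 'e) rma \<Rightarrow> 'q \<Rightarrow> nat \<Rightarrow> ('q, 'g, 'e) node set"
  for A qs w where
  root: "[] \<in> nodes A qs w"
| child: "\<pi> \<in> nodes A qs w \<Longrightarrow> length \<pi> < w \<Longrightarrow> \<delta> \<in> trans A \<Longrightarrow> src \<delta> = copied_state qs \<pi> \<Longrightarrow>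
    \<delta> # \<pi> \<in> nodes A qs w"

text \<open>
  The copy of \<open>r\<close> written last on the path to \<open>\<pi>\<close>. In the absence of such a copy, which does not
  occur when the automaton being unrolled meets the trail condition on register selections, the
  result is \<open>([], r)\<close>, which is never written.
\<close>

fun last_copy :: "('q, 'g, 'e) node \<Rightarrow> 'g \<Rightarrow> ('q, 'g, 'e) node \<times> 'g" where
  "last_copy [] r = ([], r)"
| "last_copy (\<delta> # \<pi>) r = (if r \<in> writes \<delta> then (\<delta> # \<pi>, r) else last_copy \<pi> r)"

definition unroll ::
  "('q, 'g, 'e) rma \<Rightarrow> 'q \<Rightarrow> nat \<Rightarrow>
   (('q, 'g, 'e) node, ('q, 'g, 'e) node \<times> 'g, 'e) rma" where
  "unroll A qs w = \<lparr>states = nodes A qs w, starts = {[]},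
     finals = {\<pi> \<in> nodes A qs w. copied_state qs \<pi> \<in> finals A},
     regs = {(\<delta> # \<pi>, r) | \<delta> \<pi> r. \<delta> # \<pi> \<in> nodes A qs w \<and> r \<in> writes \<delta>},
     trans = {Read \<pi> (fml \<delta>) (map (map_option (last_copy \<pi>)) (sel \<delta>))
                (\<delta> # \<pi>) (Pair (\<delta> # \<pi>) ` writes \<delta>) (out \<delta>)
              | \<delta> \<pi>. \<delta> # \<pi> \<in> nodes A qs w}\<rparr>"

definition add_self_loop :: "'q \<Rightarrow> ('q, 'g, 'e) rma \<Rightarrow> ('q, 'g, 'e) rma" where
  "add_self_loop q A = A\<lparr>trans := insert (Read q true_fml [None] q {} Skip) (trans A)\<rparr>"

type_synonym ('v, 'e) urma =
  "((sname, 'v, 'e) node, (sname, 'v, 'e) node \<times> 'v, 'e) rma"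

primrec urma :: "('e \<Rightarrow> 'r) \<Rightarrow> ('r, 'e, 'v) windowed_cepl \<Rightarrow> ('v, 'e) urma" where
  "urma type_of (\<psi> WINDOW w) =
     (let A = rma_of type_of \<psi> in
      add_self_loop [] (unroll (eps_free (underlying A)) (lstart A) w))"

end

theory Submission
  imports Defs
begin

text \<open>
  A stream is accepted by the URMA iff, for some index \<open>i\<close>, a path from the root to a final state
  whose last output is \<open>\<bullet>\<close> fits the events ending at \<open>i\<close>. Such a path has length at most \<open>w\<close>, each
  register it reads holds an event at a fixed position of the path, and there are finitely many
  paths, so the condition is a single selection formula \<open>F\<close> on the last \<open>w\<close> events. The deterministic
  automaton keeps these events in \<open>w\<close> registers used cyclically and only decides between \<open>F\<close>, which
  leads to its final state, and \<open>\<not> F\<close>.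
\<close>

section \<open>Definable conditions on finitely many events\<close>

lemma holds_cong: "(\<And>x. x \<in> fvar f \<Longrightarrow> \<sigma> x = \<tau> x) \<Longrightarrow> holds \<sigma> f \<longleftrightarrow> holds \<tau> f"
proof (induction f)
  case (Atom P xs)
  then have "map \<sigma> xs = map \<tau> xs" by simp
  then show ?case by (simp only: holds.simps)
qed auto

lemma holds_map_formula: "holds \<sigma> (map_formula h f) \<longleftrightarrow> holds (\<lambda>x. \<sigma> (h x)) f"
  by (induction f) (auto simp: comp_def)

lemma selection_formula_map_formula:
  "selection_formula preds (map_formula h f) \<longleftrightarrow> selection_formula preds f"
  by (induction f) auto

text \<open>Conditions on events are handled semantically and composed as predicates; a concrete
  formula is extracted only at the end, by \<open>definable_full\<close>.\<close>

definition definable :: "'e predicate set \<Rightarrow> nat \<Rightarrow> ((nat \<Rightarrow> 'e) \<Rightarrow> bool) \<Rightarrow> bool" where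
  "definable preds n P \<longleftrightarrow>
     (\<exists>f. selection_formula preds f \<and> fvar f \<subseteq> {..<n} \<and> (\<forall>\<sigma>. holds \<sigma> f \<longleftrightarrow> P \<sigma>))"

lemma definable_cong:
  assumes "definable preds n P" "\<And>j. j < n \<Longrightarrow> \<sigma> j = \<tau> j"
  shows "P \<sigma> \<longleftrightarrow> P \<tau>"
proof -
  obtain f where "fvar f \<subseteq> {..<n}" "\<forall>\<sigma>. holds \<sigma> f \<longleftrightarrow> P \<sigma>"
    using assms(1) unfolding definable_def by blast
  moreover from this have "holds \<sigma> f \<longleftrightarrow> holds \<tau> f"
    by (intro holds_cong assms(2)) auto
  ultimately show ?thesis by simp
qed

lemma definable_neg: "definable preds n P \<Longrightarrow> definable preds n (\<lambda>\<sigma>. \<not> P \<sigma>)"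
  unfolding definable_def
  by (metis formula.set(2) holds.simps(2) selection_formula.simps(2))

lemma definable_conj:
  assumes "definable preds n P" "definable preds n Q"
  shows "definable preds n (\<lambda>\<sigma>. P \<sigma> \<and> Q \<sigma>)"
proof -
  obtain f g where "selection_formula preds f" "fvar f \<subseteq> {..<n}" "\<forall>\<sigma>. holds \<sigma> f \<longleftrightarrow> P \<sigma>"
    "selection_formula preds g" "fvar g \<subseteq> {..<n}" "\<forall>\<sigma>. holds \<sigma> g \<longleftrightarrow> Q \<sigma>"
    using assms unfolding definable_def by blast
  then show ?thesis
    unfolding definable_def by (intro exI[of _ "Conj f g"]) auto
qed

lemma definable_disj:
  assumes "definable preds n P" "definable preds n Q"
  shows "definable preds n (\<lambda>\<sigma>. P \<sigma> \<or> Q \<sigma>)"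
  using definable_neg[OF definable_conj[OF assms[THEN definable_neg]]] by simp

text \<open>The grammar of formulas has no constants, so truth is expressed by an atom on position
  0. This is why \<open>0 < n\<close> is assumed.\<close>

lemma definable_const:
  assumes "true_pred \<in> preds" "0 < n"
  shows "definable preds n (\<lambda>\<sigma>. b)"
proof -
  have "definable preds n (\<lambda>\<sigma>. True)"
    unfolding definable_def using assms
    by (intro exI[of _ "Atom true_pred [0]"]) (auto simp: true_pred_def)
  from this definable_neg[OF this] show ?thesis by (cases b) auto
qed

lemma definable_bex:
  assumes "true_pred \<in> preds" "0 < n" "finite N" "\<And>x. x \<in> N \<Longrightarrow> definable preds n (P x)"
  shows "definable preds n (\<lambda>\<sigma>. \<exists>x\<in>N. P x \<sigma>)"
  using assms(3,4)
proof (induction N)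
  case empty
  then show ?case using definable_const[OF assms(1,2), of False] by simp
next
  case (insert x N)
  then show ?case by (auto intro!: definable_disj)
qed

lemma definable_subst:
  assumes "definable preds m P" "\<And>j. j < m \<Longrightarrow> h j < n"
  shows "definable preds n (\<lambda>\<sigma>. P (\<lambda>j. \<sigma> (h j)))"
proof -
  obtain f where "selection_formula preds f" "fvar f \<subseteq> {..<m}" "\<forall>\<sigma>. holds \<sigma> f \<longleftrightarrow> P \<sigma>"
    using assms(1) unfolding definable_def by blast
  then show ?thesis
    unfolding definable_def using assms(2)
    by (intro exI[of _ "map_formula h f"])
       (auto simp: selection_formula_map_formula holds_map_formula formula.set_map)
qed

text \<open>Selection formulas of an RMA have to mention every position of the register selection.\<close>

lemma definable_full:
  assumes "true_pred \<in> preds" "definable preds n P"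
  obtains f where "selection_formula preds f" "fvar f = {..<n}" "\<And>\<sigma>. holds \<sigma> f \<longleftrightarrow> P \<sigma>"
proof -
  obtain f where f: "selection_formula preds f" "fvar f \<subseteq> {..<n}" "\<And>\<sigma>. holds \<sigma> f \<longleftrightarrow> P \<sigma>"
    using assms(2) unfolding definable_def by blast
  \<comment> \<open>Conjoining \<open>true_pred\<close> on position \<open>m\<close> adds that
    variable without changing the truth value.\<close>
  have "\<exists>g. selection_formula preds g \<and> fvar g = fvar f \<union> {..<m} \<and> (\<forall>\<sigma>. holds \<sigma> g \<longleftrightarrow> P \<sigma>)" for m
  proof (induction m)
    case 0
    then show ?case using f by auto
  next
    case (Suc m)
    then obtain g where "selection_formula preds g" "fvar g = fvar f \<union> {..<m}"
      "\<forall>\<sigma>. holds \<sigma> g \<longleftrightarrow> P \<sigma>" by blast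
    then show ?case using assms(1)
      by (intro exI[of _ "Conj g (Atom true_pred [m])"]) (auto simp: true_pred_def)
  qed
  from this[of n] show ?thesis using f(2) that by (metis sup.absorb2)
qed

text \<open>Here \<open>P\<close> is a symbolic register content: register \<open>r\<close> holds
  the event at position \<open>P r\<close>, and the current event has position \<open>k\<close>.
  Resolving the selection to positions turns \<open>sat\<close> into a renaming of
  \<open>f\<close>.\<close>

lemma definable_sat:
  fixes P :: "'g \<Rightarrow> nat option" and f :: "('e, nat) formula"
  assumes preds: "true_pred \<in> preds"
    and f: "selection_formula preds f" "fvar f \<subseteq> {..<length rs}"
    and P: "\<And>r j. P r = Some j \<Longrightarrow> j < k" "k < n"
  shows "definable preds n (\<lambda>s. sat (\<lambda>r. map_option s (P r)) (s k) f rs)"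
\<comment> \<open>Whether a selected register is empty depends on \<open>P\<close> alone. If none
  is, \<open>js\<close> lists the positions read; otherwise the condition is false for all
  events.\<close>
proof (cases "\<exists>js. map (contents P k) rs = map Some js")
  case True
  then obtain js where js: "map (contents P k) rs = map Some js" by blast
  have contents: "contents (\<lambda>r. map_option s (P r)) (s k) x = map_option s (contents P k x)"
    for s :: "nat \<Rightarrow> 'e" and x by (cases x) auto
  have len: "length js = length rs" using js by (metis length_map)
  have "js ! j < n" if "j < length rs" for j
  proof -
    have "contents P k (rs ! j) = Some (js ! j)" using js len that by (metis nth_map)
    then show ?thesis using P by (cases "rs ! j") (auto dest: less_trans)
  qed
  then have h: "definable preds n (\<lambda>s. holds (\<lambda>j. s (js ! j)) f)"
    unfolding definable_def using f
    by (intro exI[of _ "map_formula (\<lambda>j. js ! j) f"])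
       (auto simp: selection_formula_map_formula holds_map_formula formula.set_map)
  have "sat (\<lambda>r. map_option s (P r)) (s k) f rs \<longleftrightarrow> holds (\<lambda>j. s (js ! j)) f" for s
  proof -
    have eq: "map (contents (\<lambda>r. map_option s (P r)) (s k)) rs = map Some (map s js)"
    proof -
      have "map (contents (\<lambda>r. map_option s (P r)) (s k)) rs = map (map_option s) (map (contents P k) rs)"
        by (simp add: contents)
      then show ?thesis using js by simp
    qed
    have inj: "map Some us = map Some vs \<longleftrightarrow> us = vs" for us vs :: "'e list"
      by (simp add: inj_map_eq_map)
    have "sat (\<lambda>r. map_option s (P r)) (s k) f rs \<longleftrightarrow> holds (\<lambda>j. map s js ! j) f"
      unfolding sat_def eq inj by auto
    also have "\<dots> \<longleftrightarrow> holds (\<lambda>j. s (js ! j)) f"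
      using f(2) len by (intro holds_cong) auto
    finally show ?thesis .
  qed
  with h show ?thesis by simp
next
  case False
  have "\<not> sat (\<lambda>r. map_option s (P r)) (s k) f rs" for s :: "nat \<Rightarrow> 'e"
  proof
    assume "sat (\<lambda>r. map_option s (P r)) (s k) f rs"
    then obtain us where us: "map (contents (\<lambda>r. map_option s (P r)) (s k)) rs = map Some us"
      unfolding sat_def by blast
    have "contents P k x \<noteq> None" if "x \<in> set rs" for x
    proof -
      have "contents (\<lambda>r. map_option s (P r)) (s k) x \<in> set (map Some us)"
        using that us by (metis image_eqI list.set_map)
      then show ?thesis by (cases x) auto
    qed
    then have "map (contents P k) rs = map Some (map (\<lambda>x. the (contents P k x)) rs)" by simp
    with False show False by blast
  qed
  then show ?thesis using definable_const[OF preds, of n False] P(2) by simp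
qed

section \<open>Acceptance as reachability\<close>

abbreviation reaches ::
  "('q, 'g, 'e) rma \<Rightarrow> 'e event_stream \<Rightarrow> ('q, 'g, 'e) config \<Rightarrow> ('q, 'g, 'e) config \<Rightarrow> bool" where
  "reaches A S \<equiv> (\<lambda>c c'. \<exists>\<delta>. successor A S c \<delta> c')\<^sup>*\<^sup>*"

lemma successor_trans: "successor A S c \<delta> c' \<Longrightarrow> \<delta> \<in> trans A"
  by (auto elim: successor.cases)

lemma run_reaches:
  assumes "run A S cs \<delta>s" "k \<le> length \<delta>s"
  shows "\<exists>q\<in>starts A. reaches A S (0, q, \<lambda>_. None) (cs ! k)"
  using assms(2)
proof (induction k)
  case 0
  then show ?case using assms(1) unfolding run_def by auto
next
  case (Suc k)
  then obtain q where "q \<in> starts A" "reaches A S (0, q, \<lambda>_. None) (cs ! k)" by auto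
  moreover have "successor A S (cs ! k) (\<delta>s ! k) (cs ! Suc k)"
    using assms(1) Suc.prems unfolding run_def by auto
  ultimately show ?case by (blast intro: rtranclp.rtrancl_into_rtrancl)
qed

lemma run_snoc:
  assumes "run A S cs \<delta>s" "successor A S (last cs) \<delta> c"
  shows "run A S (cs @ [c]) (\<delta>s @ [\<delta>])"
proof -
  have len: "length cs = Suc (length \<delta>s)" using assms(1) unfolding run_def by simp
  then have "last cs = cs ! length \<delta>s" by (subst last_conv_nth) auto
  then show ?thesis
    using assms len unfolding run_def by (auto simp: nth_append less_Suc_eq)
qed

lemma reaches_run:
  assumes "reaches A S (0, q, \<lambda>_. None) c" "q \<in> starts A"
  shows "\<exists>cs \<delta>s. run A S cs \<delta>s \<and> last cs = c"
  using assms(1)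
proof (induction rule: rtranclp_induct)
  case base
  have "run A S [(0, q, \<lambda>_. None)] []" unfolding run_def using assms(2) by simp
  then show ?case by fastforce
next
  case (step c c')
  then obtain cs \<delta>s \<delta> where "run A S cs \<delta>s" "successor A S (last cs) \<delta> c'" by blast
  from run_snoc[OF this] show ?case by (intro exI) (auto intro: last_snoc)
qed

text \<open>Without \<open>Eps\<close> transitions the last transition of a run is also the last one
  that consumes an event, so both acceptance conditions concern a single step from a reachable
  configuration.\<close>

lemma accepting_run_iff:
  assumes reads: "\<And>\<delta>. \<delta> \<in> trans A \<Longrightarrow> is_Read \<delta>" and start: "starts A = {q}"
  shows "(\<exists>cs \<delta>s. accepting_run A S cs \<delta>s) \<longleftrightarrow>
    (\<exists>c \<delta> c'. reaches A S (0, q, \<lambda>_. None) c \<and> successor A S c \<delta> c' \<and>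
       fst (snd c') \<in> finals A \<and> out \<delta> = Mark)" (is "?L \<longleftrightarrow> ?R")
proof
  have id: "filter is_Read \<delta>s = \<delta>s" if "run A S cs \<delta>s" for cs \<delta>s
  proof -
    have "is_Read \<delta>" if "\<delta> \<in> set \<delta>s" for \<delta>
      using that \<open>run A S cs \<delta>s\<close> unfolding run_def
      by (metis in_set_conv_nth reads successor_trans)
    then show ?thesis by simp
  qed
  {
    assume ?L
    then obtain cs \<delta>s where acc: "accepting_run A S cs \<delta>s" by blast
    then have run: "run A S cs \<delta>s" and fin: "fst (snd (last cs)) \<in> finals A"
      unfolding accepting_run_def by auto
    from acc id[OF run] have ne: "\<delta>s \<noteq> []" and out: "out (last \<delta>s) = Mark"
      unfolding accepting_run_def Let_def by auto
    define k where "k = length \<delta>s - 1"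
    have k: "length \<delta>s = Suc k" using ne unfolding k_def by simp
    have len: "length cs = Suc (Suc k)" using run k unfolding run_def by simp
    then have "last cs = cs ! Suc k" by (subst last_conv_nth) auto
    moreover have "last \<delta>s = \<delta>s ! k" using ne k by (simp add: last_conv_nth)
    moreover have "successor A S (cs ! k) (\<delta>s ! k) (cs ! Suc k)"
      using run k unfolding run_def by simp
    moreover have "reaches A S (0, q, \<lambda>_. None) (cs ! k)"
      using run_reaches[OF run, of k] k start by simp
    ultimately show ?R using fin out by metis
  next
    assume ?R
    then obtain c \<delta> c' where c: "reaches A S (0, q, \<lambda>_. None) c" "successor A S c \<delta> c'"
      "fst (snd c') \<in> finals A" "out \<delta> = Mark" by blast
    then obtain cs \<delta>s where "run A S cs \<delta>s" "last cs = c"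
      using reaches_run[OF c(1)] start by auto
    then have "run A S (cs @ [c']) (\<delta>s @ [\<delta>])" using run_snoc c(2) by blast
    then have "accepting_run A S (cs @ [c']) (\<delta>s @ [\<delta>])"
      using id[of "cs @ [c']" "\<delta>s @ [\<delta>]"] c(3,4) unfolding accepting_run_def Let_def by simp
    then show ?L by blast
  }
qed

lemma event_at_down: "event_at S i \<noteq> None \<Longrightarrow> j \<le> i \<Longrightarrow> event_at S j \<noteq> None"
  by (cases S) (auto split: if_splits)

section \<open>Acceptance of an unrolled automaton\<close>

text \<open>
  The position on the path \<open>\<pi>\<close> of the event held by register \<open>r\<close> after that path; the self-loop at
  the root does not write.
\<close>

fun reg_pos :: "('q, 'g, 'e) node \<Rightarrow> ('q, 'g, 'e) node \<times> 'g \<Rightarrow> nat option" where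
  "reg_pos [] r = None"
| "reg_pos (\<delta> # \<pi>) r = (if r \<in> Pair (\<delta> # \<pi>) ` writes \<delta> then Some (length \<pi>) else reg_pos \<pi> r)"

text \<open>Positions count from the root: \<open>s j\<close> is the event consumed by the
  transition at depth \<open>j\<close>. As nodes list the most recent transition first, the head
  consumes \<open>s (length \<pi>)\<close>.\<close>

fun fits :: "(nat \<Rightarrow> 'e) \<Rightarrow> ('q, 'g, 'e) node \<Rightarrow> bool" where
  "fits s [] \<longleftrightarrow> True"
| "fits s (\<delta> # \<pi>) \<longleftrightarrow> fits s \<pi> \<and>
     sat (\<lambda>r. map_option s (reg_pos \<pi> r)) (s (length \<pi>)) (fml \<delta>)
       (map (map_option (last_copy \<pi>)) (sel \<delta>))"

text \<open>This is the syntactic condition carried through all steps of the construction. It is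
  vacuous for \<open>Eps\<close>, where \<open>fml\<close> is unspecified.\<close>

definition selective :: "'e predicate set \<Rightarrow> ('q, 'g, 'e) transition \<Rightarrow> bool" where
  "selective preds \<delta> \<longleftrightarrow>
     (is_Read \<delta> \<longrightarrow> selection_formula preds (fml \<delta>) \<and> fvar (fml \<delta>) \<subseteq> {..<length (sel \<delta>)})"

lemma reg_pos_less: "reg_pos \<pi> r = Some j \<Longrightarrow> j < length \<pi>"
  by (induction \<pi>) (auto split: if_splits)

text \<open>Registers only hold events from earlier positions of the path
  (\<open>reg_pos_less\<close>), so \<open>definable_sat\<close> applies to each step with
  \<open>length \<pi>\<close> as the current position.\<close>

lemma definable_fits:
  assumes "true_pred \<in> preds" "0 < n" "length \<pi> \<le> n"
    and "\<And>\<delta>. \<delta> \<in> set \<pi> \<Longrightarrow> is_Read \<delta> \<and> selective preds \<delta>"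
  shows "definable preds n (\<lambda>s. fits s \<pi>)"
  using assms(3,4)
proof (induction \<pi>)
  case Nil
  then show ?case using definable_const[OF assms(1,2), of True] by simp
next
  case (Cons \<delta> \<pi>)
  have "definable preds n (\<lambda>s. sat (\<lambda>r. map_option s (reg_pos \<pi> r)) (s (length \<pi>)) (fml \<delta>)
       (map (map_option (last_copy \<pi>)) (sel \<delta>)))"
    using Cons.prems assms(1)
    by (intro definable_sat) (auto simp: selective_def dest: reg_pos_less)
  with Cons show ?case by (auto intro!: definable_conj)
qed

lemma nodes_trans: "\<pi> \<in> nodes A q w \<Longrightarrow> set \<pi> \<subseteq> trans A \<and> length \<pi> \<le> w"
  by (induction rule: nodes.induct) auto

lemma finite_nodes: "finite (trans A) \<Longrightarrow> finite (nodes A q w)"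
  by (rule finite_subset[OF _ finite_lists_length_le[of "trans A" w]]) (auto dest: nodes_trans)

lemma nodes_ConsD: "\<delta> # \<pi> \<in> nodes A q w \<Longrightarrow> \<pi> \<in> nodes A q w"
  by (auto elim: nodes.cases)

section \<open>Reachable configurations of the unrolled automaton\<close>

abbreviation (input) events_from :: "'e event_stream \<Rightarrow> nat \<Rightarrow> nat \<Rightarrow> 'e" where
  "events_from S n \<equiv> \<lambda>j. the (event_at S (n + j))"

text \<open>The configuration after \<open>n\<close> turns of the self-loop followed by the path
  \<open>\<pi>\<close>; these two data determine index, state and registers.\<close>

abbreviation (input) tree_config ::
  "'e event_stream \<Rightarrow> nat \<Rightarrow> ('q, 'g, 'e) node \<Rightarrow>
   (('q, 'g, 'e) node, ('q, 'g, 'e) node \<times> 'g, 'e) config" where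
  "tree_config S n \<pi> \<equiv> (n + length \<pi>, \<pi>, \<lambda>r. map_option (events_from S n) (reg_pos \<pi> r))"

lemma self_loop_trans:
  "trans (add_self_loop [] (unroll A q w)) =
     insert (Read [] true_fml [None] [] {} Skip)
       {Read \<pi> (fml \<delta>) (map (map_option (last_copy \<pi>)) (sel \<delta>))
          (\<delta> # \<pi>) (Pair (\<delta> # \<pi>) ` writes \<delta>) (out \<delta>) | \<delta> \<pi>. \<delta> # \<pi> \<in> nodes A q w}"
  by (simp add: add_self_loop_def unroll_def)

lemma sat_true_fml: "sat \<gamma> t true_fml [None]"
  by (auto simp: sat_def true_fml_def true_pred_def intro: exI[of _ "[t]"])

lemma tree_step:
  assumes "\<delta> # \<pi> \<in> nodes A q w" "fits (events_from S n) (\<delta> # \<pi>)"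
    and "event_at S (n + length \<pi>) \<noteq> None"
  shows "successor (add_self_loop [] (unroll A q w)) S (tree_config S n \<pi>)
    (Read \<pi> (fml \<delta>) (map (map_option (last_copy \<pi>)) (sel \<delta>))
      (\<delta> # \<pi>) (Pair (\<delta> # \<pi>) ` writes \<delta>) (out \<delta>)) (tree_config S n (\<delta> # \<pi>))"
proof -
  obtain t where t: "event_at S (n + length \<pi>) = Some t" using assms(3) by blast
  have "successor (add_self_loop [] (unroll A q w)) S (tree_config S n \<pi>)
    (Read \<pi> (fml \<delta>) (map (map_option (last_copy \<pi>)) (sel \<delta>))
      (\<delta> # \<pi>) (Pair (\<delta> # \<pi>) ` writes \<delta>) (out \<delta>))
    (Suc (n + length \<pi>), \<delta> # \<pi>, \<lambda>r. if r \<in> Pair (\<delta> # \<pi>) ` writes \<delta> then Some t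
       else map_option (events_from S n) (reg_pos \<pi> r))"
    using assms t by (intro successor.read) (auto simp: self_loop_trans)
  also have "(\<lambda>r. if r \<in> Pair (\<delta> # \<pi>) ` writes \<delta> then Some t
       else map_option (events_from S n) (reg_pos \<pi> r)) =
    (\<lambda>r. map_option (events_from S n) (reg_pos (\<delta> # \<pi>) r))"
    using t by auto
  finally show ?thesis by simp
qed

text \<open>The self-loop exists only at the root, where all registers are still empty; taking it
  just delays the start of the path by one event. Every other step extends the path.\<close>

lemma tree_successor_cases:
  assumes "successor (add_self_loop [] (unroll A q w)) S (tree_config S n \<pi>) \<epsilon> c"
    and "fits (events_from S n) \<pi>"
  obtains (loop) "\<pi> = []" "out \<epsilon> = Skip" "c = tree_config S (Suc n) []"
  | (tree) \<delta> where "\<delta> # \<pi> \<in> nodes A q w" "fits (events_from S n) (\<delta> # \<pi>)"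
      "event_at S (n + length \<pi>) \<noteq> None" "out \<epsilon> = out \<delta>" "c = tree_config S n (\<delta> # \<pi>)"
  using assms(1)
proof (cases rule: successor.cases)
  case (eps p)
  then show thesis by (simp add: self_loop_trans)
next
  case (read f rs p R z t)
  from read(3) consider "\<pi> = []" "R = {}" "p = []" "z = Skip"
    | \<delta> where "\<delta> # \<pi> \<in> nodes A q w" "f = fml \<delta>"
      "rs = map (map_option (last_copy \<pi>)) (sel \<delta>)" "p = \<delta> # \<pi>"
      "R = Pair (\<delta> # \<pi>) ` writes \<delta>" "z = out \<delta>"
    unfolding self_loop_trans by blast
  then show thesis
  proof cases
    case 1
    then show thesis using read loop by simp
  next
    case 2
    have "c = tree_config S n (\<delta> # \<pi>)" using read(2,4) 2 by (auto simp: fun_eq_iff)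
    with 2 read assms(2) show thesis by (intro tree[of \<delta>]) auto
  qed
qed

lemma reaches_tree_config:
  assumes "reaches (add_self_loop [] (unroll A q w)) S (0, [], \<lambda>_. None) c"
  shows "\<exists>n \<pi>. c = tree_config S n \<pi> \<and> fits (events_from S n) \<pi>"
  using assms
proof (induction rule: rtranclp_induct)
  case base
  show ?case by (intro exI[of _ 0] exI[of _ "[]"]) simp
next
  case (step c c')
  then obtain n \<pi> \<epsilon> where c: "c = tree_config S n \<pi>" and fits: "fits (events_from S n) \<pi>"
    and \<epsilon>: "successor (add_self_loop [] (unroll A q w)) S c \<epsilon> c'" by blast
  from \<epsilon>[unfolded c] fits show ?case
  proof (cases rule: tree_successor_cases)
    case loop
    then show ?thesis by (metis fits.simps(1))
  next
    case (tree \<delta>)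
    then show ?thesis by blast
  qed
qed

lemma tree_config_reachable:
  assumes "\<pi> \<in> nodes A q w" "fits (events_from S n) \<pi>"
    and "\<And>j. j < n + length \<pi> \<Longrightarrow> event_at S j \<noteq> None"
  shows "reaches (add_self_loop [] (unroll A q w)) S (0, [], \<lambda>_. None) (tree_config S n \<pi>)"
  using assms
proof (induction \<pi> rule: list.induct)
  case Nil
  \<comment> \<open>The first \<open>n\<close> events are consumed by the self-loop, whose formula
    is always true.\<close>
  from Nil(3) have "reaches (add_self_loop [] (unroll A q w)) S (0, [], \<lambda>_. None) (n, [], \<lambda>_. None)"
  proof (induction n)
    case (Suc n)
    obtain t where "event_at S n = Some t" using Suc.prems[of n] by auto
    then have "successor (add_self_loop [] (unroll A q w)) S (n, [], \<lambda>_. None)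
        (Read [] true_fml [None] [] {} Skip) (Suc n, [], \<lambda>r. if r \<in> {} then Some t else None)"
      by (intro successor.read) (auto simp: self_loop_trans sat_true_fml)
    then have "successor (add_self_loop [] (unroll A q w)) S (n, [], \<lambda>_. None)
        (Read [] true_fml [None] [] {} Skip) (Suc n, [], \<lambda>_. None)" by simp
    moreover have "reaches (add_self_loop [] (unroll A q w)) S (0, [], \<lambda>_. None) (n, [], \<lambda>_. None)"
      using Suc by simp
    ultimately show ?case by (blast intro: rtranclp.rtrancl_into_rtrancl)
  qed simp
  then show ?case by simp
next
  case (Cons \<delta> \<pi>)
  have "reaches (add_self_loop [] (unroll A q w)) S (0, [], \<lambda>_. None) (tree_config S n \<pi>)"
    using Cons.prems by (intro Cons.IH) (auto dest: nodes_ConsD)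
  moreover have "event_at S (n + length \<pi>) \<noteq> None" using Cons.prems(3) by simp
  ultimately show ?case
    using tree_step[OF Cons.prems(1,2)] by (blast intro: rtranclp.rtrancl_into_rtrancl)
qed

text \<open>The last step of an accepting run outputs \<open>Mark\<close>, so it is not the
  self-loop and ends a nonempty path. Conversely, the self-loop can skip all events before the
  path.\<close>

lemma urma_accepts_iff:
  "(\<exists>cs \<delta>s. accepting_run (add_self_loop [] (unroll A q w)) S cs \<delta>s) \<longleftrightarrow>
   (\<exists>n \<delta> \<pi>. \<delta> # \<pi> \<in> nodes A q w \<and> tgt \<delta> \<in> finals A \<and> out \<delta> = Mark \<and>
      event_at S (n + length \<pi>) \<noteq> None \<and> fits (events_from S n) (\<delta> # \<pi>))" (is "?L \<longleftrightarrow> ?R")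
proof -
  let ?U = "add_self_loop [] (unroll A q w)"
  have finals: "finals ?U = {\<pi> \<in> nodes A q w. copied_state q \<pi> \<in> finals A}"
    by (simp add: add_self_loop_def unroll_def)
  have "?L \<longleftrightarrow> (\<exists>c \<epsilon> c'. reaches ?U S (0, [], \<lambda>_. None) c \<and> successor ?U S c \<epsilon> c' \<and>
       fst (snd c') \<in> finals ?U \<and> out \<epsilon> = Mark)"
    by (rule accepting_run_iff) (auto simp: self_loop_trans add_self_loop_def unroll_def)
  also have "\<dots> \<longleftrightarrow> ?R"
  proof
    assume "\<exists>c \<epsilon> c'. reaches ?U S (0, [], \<lambda>_. None) c \<and> successor ?U S c \<epsilon> c' \<and>
       fst (snd c') \<in> finals ?U \<and> out \<epsilon> = Mark"
    then obtain c \<epsilon> c' where r: "reaches ?U S (0, [], \<lambda>_. None) c" and s: "successor ?U S c \<epsilon> c'"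
      and fin: "fst (snd c') \<in> finals ?U" and out: "out \<epsilon> = Mark" by blast
    obtain n \<pi> where c: "c = tree_config S n \<pi>" and fits: "fits (events_from S n) \<pi>"
      using reaches_tree_config[OF r] by blast
    from s[unfolded c] fits show ?R
    proof (cases rule: tree_successor_cases)
      case loop
      with out show ?thesis by simp
    next
      case (tree \<delta>)
      moreover have "tgt \<delta> \<in> finals A" using fin tree(5) unfolding finals by simp
      ultimately show ?thesis using out by metis
    qed
  next
    assume ?R
    then obtain n \<delta> \<pi> where n: "\<delta> # \<pi> \<in> nodes A q w" "tgt \<delta> \<in> finals A" "out \<delta> = Mark"
      "event_at S (n + length \<pi>) \<noteq> None" "fits (events_from S n) (\<delta> # \<pi>)" by blast
    have "reaches ?U S (0, [], \<lambda>_. None) (tree_config S n \<pi>)"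
    proof (rule tree_config_reachable)
      show "event_at S j \<noteq> None" if "j < n + length \<pi>" for j
        using event_at_down[OF n(4)] that by simp
    qed (use n nodes_ConsD in auto)
    with tree_step[OF n(1,5,4)] show "\<exists>c \<epsilon> c'. reaches ?U S (0, [], \<lambda>_. None) c \<and>
        successor ?U S c \<epsilon> c' \<and> fst (snd c') \<in> finals ?U \<and> out \<epsilon> = Mark"
      using n(1,2,3) by (intro exI conjI) (auto simp: finals)
  qed
  finally show ?thesis .
qed

section \<open>The deterministic window automaton\<close>

text \<open>
  State \<open>c < 2 * w\<close> is reached after \<open>i\<close> events, where \<open>c = i\<close> if \<open>i < w\<close> and otherwise \<open>c\<close> is the
  element of \<open>{w..<2 * w}\<close> congruent to \<open>i\<close> modulo \<open>w\<close>; the event of index \<open>i\<close> is written to register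
  \<open>i mod w\<close>. Keeping the first \<open>w\<close> states apart from the cycle ensures that no empty register is read.
  Position \<open>v\<close> of a selection holds the event \<open>v\<close> steps before the current one.
\<close>

definition window_sel :: "nat \<Rightarrow> nat \<Rightarrow> nat option list" where
  "window_sel w c = map (\<lambda>v. if v = 0 then None else Some ((c - v) mod w)) [0..<min (Suc c) w]"

definition next_state :: "nat \<Rightarrow> nat \<Rightarrow> nat" where
  "next_state w c = (if Suc c = 2 * w then w else Suc c)"

text \<open>\<open>F m\<close> is meant for \<open>m\<close> available events, the current one
  included. State \<open>2 * w\<close> has no outgoing transition: the first hit ends the run, and
  nothing has to be recorded.\<close>

definition hit :: "nat \<Rightarrow> (nat \<Rightarrow> ('e, nat) formula) \<Rightarrow> nat \<Rightarrow> (nat, nat, 'e) transition" where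
  "hit w F c = Read c (F (min (Suc c) w)) (window_sel w c) (2 * w) {} Mark"

definition miss :: "nat \<Rightarrow> (nat \<Rightarrow> ('e, nat) formula) \<Rightarrow> nat \<Rightarrow> (nat, nat, 'e) transition" where
  "miss w F c =
     Read c (Neg (F (min (Suc c) w))) (window_sel w c) (next_state w c) {c mod w} Skip"

definition window_rma :: "nat \<Rightarrow> (nat \<Rightarrow> ('e, nat) formula) \<Rightarrow> (nat, nat, 'e) rma" where
  "window_rma w F = \<lparr>states = {..2 * w}, starts = {0}, finals = {2 * w}, regs = {..<w},
     trans = hit w F ` {..<2 * w} \<union> miss w F ` {..<2 * w}\<rparr>"

fun nth_state :: "nat \<Rightarrow> nat \<Rightarrow> nat" where
  "nth_state w 0 = 0"
| "nth_state w (Suc i) = next_state w (nth_state w i)"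

text \<open>The residue of the state locates the registers, and its minimum with \<open>w\<close>
  tells how many past events are stored. So the bounded state can stand in for the index
  \<open>i\<close>.\<close>

lemma nth_state:
  assumes "0 < w"
  shows "nth_state w i < 2 * w \<and> nth_state w i mod w = i mod w \<and> min (nth_state w i) w = min i w"
proof (induction i)
  case (Suc i)
  show ?case
  proof (cases "Suc (nth_state w i) = 2 * w")
    case True
    then have "Suc i mod w = 0" using Suc by (metis mod_Suc_eq mod_mult_self2_is_0)
    then show ?thesis using True Suc assms by (auto simp: next_state_def min_def split: if_splits)
  next
    case False
    have "Suc (nth_state w i) mod w = Suc i mod w" using Suc by (metis mod_Suc_eq)
    then show ?thesis using False Suc by (auto simp: next_state_def min_def split: if_splits)
  qed
qed (use assms in auto)

section \<open>Trail condition and determinism of the window automaton\<close>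

lemma path_snoc: "path p (\<delta>s @ [\<delta>]) q \<longleftrightarrow> path p \<delta>s (src \<delta>) \<and> tgt \<delta> = q"
  by (induction \<delta>s arbitrary: p) auto

text \<open>To leave the initial segment, a path must go through its states one by one, and each of
  them writes the register of its own number. With \<open>window_sel_register\<close> this gives the
  trail condition.\<close>

lemma window_rma_path_writes:
  assumes "0 < w" "path 0 \<delta>s c" "set \<delta>s \<subseteq> trans (window_rma w F)" "c < 2 * w" "r < min c w"
  shows "\<exists>\<epsilon>\<in>set \<delta>s. r \<in> writes \<epsilon>"
  using assms(2-5)
proof (induction \<delta>s arbitrary: c rule: rev_induct)
  case (snoc \<delta> \<delta>s)
  then have "path 0 \<delta>s (src \<delta>)" "tgt \<delta> = c" by (auto simp: path_snoc)
  \<comment> \<open>The last transition is not a \<open>hit\<close>, since its target lies below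
    \<open>2 * w\<close>.\<close>
  moreover obtain c' where c': "c' < 2 * w" "\<delta> = miss w F c'"
    using snoc.prems \<open>tgt \<delta> = c\<close> by (auto simp: window_rma_def hit_def)
  ultimately have "path 0 \<delta>s c'" "c = next_state w c'" by (auto simp: miss_def)
  show ?case
  proof (cases "r < min c' w")
    case True
    then show ?thesis using snoc.IH[OF \<open>path 0 \<delta>s c'\<close>] snoc.prems c' by auto
  next
    case False
    \<comment> \<open>Here \<open>c' < w\<close>: otherwise \<open>min c' w = w\<close> already
      exceeds \<open>r\<close>. So the step goes to \<open>Suc c'\<close>, and the only new register
      is \<open>c'\<close> itself.\<close>
    then have "r = c' mod w"
      using \<open>c = next_state w c'\<close> snoc.prems(4) by (auto simp: next_state_def split: if_splits)
    then show ?thesis using c' by (auto simp: miss_def)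
  qed
qed simp

lemma window_sel_register:
  assumes "0 < w" "Some r \<in> set (window_sel w c)"
  shows "r < min c w"
proof -
  obtain v where "v < min (Suc c) w" "v \<noteq> 0" "r = (c - v) mod w"
    using assms(2) by (auto simp: window_sel_def split: if_splits)
  then show ?thesis
    using assms(1) by (auto simp: mod_less_divisor intro: le_less_trans[OF mod_less_eq_dividend])
qed

lemma window_rma_is_rma:
  assumes "0 < w"
    and F: "\<And>m. 0 < m \<Longrightarrow> m \<le> w \<Longrightarrow> selection_formula preds (F m) \<and> fvar (F m) = {..<m}"
  shows "is_rma preds (window_rma w F)"
proof -
  have sel: "set (window_sel w c) \<subseteq> insert None (Some ` {..<w})" for c
    using assms(1) by (auto simp: window_sel_def)
  have fml: "selection_formula preds (F (min (Suc c) w)) \<and>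
      fvar (F (min (Suc c) w)) = {..<length (window_sel w c)}" for c
    using F[of "min (Suc c) w"] assms(1) by (simp add: window_sel_def)
  have trail: "\<exists>\<epsilon>\<in>set \<delta>s. r \<in> writes \<epsilon>"
    if "\<delta> \<in> trans (window_rma w F)" "Some r \<in> set (sel \<delta>)" "trail (window_rma w F) \<delta>s (src \<delta>)"
    for \<delta> \<delta>s r
  proof -
    have "src \<delta> < 2 * w" "sel \<delta> = window_sel w (src \<delta>)"
      using that(1) by (auto simp: window_rma_def hit_def miss_def)
    moreover have "path 0 \<delta>s (src \<delta>)" "set \<delta>s \<subseteq> trans (window_rma w F)"
      using that(3) by (auto simp: trail_def window_rma_def)
    ultimately show ?thesis
      using window_rma_path_writes[OF assms(1)] window_sel_register[OF assms(1)] that(2) by metis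
  qed
  have "\<forall>q f rs p R z. Read q f rs p R z \<in> trans (window_rma w F) \<longrightarrow>
      selection_formula preds f \<and> fvar f = {..<length rs} \<and>
      set rs \<subseteq> insert None (Some ` regs (window_rma w F)) \<and> R \<subseteq> regs (window_rma w F)"
    using fml sel assms(1) by (auto simp: window_rma_def hit_def miss_def)
  moreover have "\<forall>\<delta>\<in>trans (window_rma w F).
      src \<delta> \<in> states (window_rma w F) \<and> tgt \<delta> \<in> states (window_rma w F)"
    by (auto simp: window_rma_def hit_def miss_def next_state_def)
  moreover have "finite (states (window_rma w F))" "starts (window_rma w F) \<subseteq> states (window_rma w F)"
    "finals (window_rma w F) \<subseteq> states (window_rma w F)" "finite (regs (window_rma w F))"
    "finite (trans (window_rma w F))"
    by (auto simp: window_rma_def)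
  moreover have "\<forall>\<delta>\<in>trans (window_rma w F). \<forall>r. Some r \<in> set (sel \<delta>) \<longrightarrow>
      (\<forall>\<delta>s. trail (window_rma w F) \<delta>s (src \<delta>) \<longrightarrow> (\<exists>\<epsilon>\<in>set \<delta>s. r \<in> writes \<epsilon>))"
    using trail by blast
  ultimately show ?thesis
    unfolding is_rma_def by (intro conjI)
qed

text \<open>The converse fails: an empty register falsifies both \<open>f\<close> and its
  negation.\<close>

lemma sat_Neg: "sat \<gamma> t (Neg f) rs \<Longrightarrow> \<not> sat \<gamma> t f rs"
  by (auto simp: sat_def inj_map_eq_map)

text \<open>Each state below \<open>2 * w\<close> is left by one \<open>hit\<close> and one
  \<open>miss\<close>, with the same selection and complementary formulas.\<close>

lemma window_rma_deterministic: "output_agnostic_deterministic (window_rma w F)"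
proof -
  have "\<not> (sat \<gamma> t (fml \<delta>1) (sel \<delta>1) \<and> sat \<gamma> t (fml \<delta>2) (sel \<delta>2))"
    if "\<delta>1 \<in> trans (window_rma w F)" "\<delta>2 \<in> trans (window_rma w F)" "\<delta>1 \<noteq> \<delta>2" "src \<delta>1 = src \<delta>2"
    for \<delta>1 \<delta>2 \<gamma> t
    using that by (auto simp: window_rma_def hit_def miss_def dest: sat_Neg)
  moreover have "\<forall>\<delta>\<in>trans (window_rma w F). is_Read \<delta>" "\<exists>q. starts (window_rma w F) = {q}"
    by (auto simp: window_rma_def hit_def miss_def)
  ultimately show ?thesis unfolding output_agnostic_deterministic_def by blast
qed

section \<open>Acceptance of the window automaton\<close>

definition remembers :: "nat \<Rightarrow> 'e event_stream \<Rightarrow> nat \<Rightarrow> (nat \<Rightarrow> 'e option) \<Rightarrow> bool" where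
  "remembers w S i \<gamma> \<longleftrightarrow> (\<forall>j<i. i \<le> j + w \<longrightarrow> \<gamma> (j mod w) = event_at S j \<and> event_at S j \<noteq> None)"

text \<open>The current event overwrites the one \<open>w\<close> steps earlier, which leaves the
  window. The earlier indices still required differ from \<open>i\<close> by less than
  \<open>w\<close>, so their registers are untouched.\<close>

lemma remembers_step:
  assumes "remembers w S i \<gamma>" "event_at S i = Some t"
  shows "remembers w S (Suc i) (\<lambda>r. if r \<in> {i mod w} then Some t else \<gamma> r)"
proof -
  have "j mod w \<noteq> i mod w" if "j < i" "Suc i \<le> j + w" for j
  proof
    assume "j mod w = i mod w"
    then have "w dvd i - j" using that(1) by (metis less_imp_le mod_eq_dvd_iff_nat)
    with that show False by (auto dest!: dvd_imp_le)
  qed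
  with assms show ?thesis unfolding remembers_def by (auto simp: less_Suc_eq)
qed

abbreviation (input) events_until :: "'e event_stream \<Rightarrow> nat \<Rightarrow> nat \<Rightarrow> 'e" where
  "events_until S i \<equiv> \<lambda>v. the (event_at S (i - v))"

lemma mod_diff_cong_nat:
  fixes a b v :: nat
  assumes "a mod w = b mod w" "v \<le> a" "v \<le> b"
  shows "(a - v) mod w = (b - v) mod w"
proof (cases "a \<le> b")
  case True
  then have "w dvd b - a" using assms(1) by (metis mod_eq_dvd_iff_nat)
  moreover have "b - a = (b - v) - (a - v)" using assms(2) True by simp
  ultimately show ?thesis using True by (metis diff_le_mono mod_eq_dvd_iff_nat)
next
  case False
  then have "w dvd a - b" using assms(1) by (metis mod_eq_dvd_iff_nat nat_le_linear)
  moreover have "a - b = (a - v) - (b - v)" using assms(3) False by simp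
  ultimately show ?thesis using False by (metis diff_le_mono mod_eq_dvd_iff_nat nat_le_linear)
qed

text \<open>The state is congruent to \<open>i\<close> modulo \<open>w\<close>, so the register read
  at position \<open>v\<close> is the one where the event of index \<open>i - v\<close> was stored.
  The bound on \<open>v\<close> keeps that event among the remembered ones.\<close>

lemma sat_window_sel:
  assumes "0 < w" "remembers w S i \<gamma>" "event_at S i = Some t" "fvar f \<subseteq> {..<min (Suc i) w}"
  shows "sat \<gamma> t f (window_sel w (nth_state w i)) \<longleftrightarrow> holds (events_until S i) f"
proof -
  define m where "m = min (Suc i) w"
  define c where "c = nth_state w i"
  have c: "c mod w = i mod w" "min c w = min i w" using nth_state[OF assms(1)] by (auto simp: c_def)
  then have m: "min (Suc c) w = m" unfolding m_def by (auto simp: min_def split: if_splits)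
  have "contents \<gamma> t (if v = 0 then None else Some ((c - v) mod w)) = Some (events_until S i v)"
    if "v < m" for v
  proof (cases "v = 0")
    case False
    have v: "v \<le> i" "v \<le> c" "v < w" using that m by (auto simp: m_def)
    then have "(c - v) mod w = (i - v) mod w" using c(1) mod_diff_cong_nat by blast
    then show ?thesis using assms(2) False v by (auto simp: remembers_def)
  qed (use assms(3) in simp)
  then have eq: "map (contents \<gamma> t) (window_sel w c) = map Some (map (events_until S i) [0..<m])"
    by (simp add: window_sel_def m)
  have "sat \<gamma> t f (window_sel w c) \<longleftrightarrow> holds (\<lambda>j. map (events_until S i) [0..<m] ! j) f"
    unfolding sat_def eq by (auto simp: inj_map_eq_map simp del: map_map)
  also have "\<dots> \<longleftrightarrow> holds (events_until S i) f"
    using assms(4) by (intro holds_cong) (auto simp: m_def)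
  finally show ?thesis by (simp add: c_def)
qed

text \<open>The run is forced: it misses until the first index at which the formula holds, and hits
  there.\<close>

lemma window_rma_accepts_iff:
  assumes "0 < w" and F: "\<And>m. 0 < m \<Longrightarrow> m \<le> w \<Longrightarrow> fvar (F m) = {..<m}"
  shows "(\<exists>cs \<delta>s. accepting_run (window_rma w F) S cs \<delta>s) \<longleftrightarrow>
    (\<exists>i. event_at S i \<noteq> None \<and> holds (events_until S i) (F (min (Suc i) w)))" (is "?L \<longleftrightarrow> ?R")
proof -
  let ?W = "window_rma w F"
  define good where "good i \<longleftrightarrow> holds (events_until S i) (F (min (Suc i) w))" for i
  have lt: "nth_state w i < 2 * w" for i using nth_state[OF assms(1)] by blast
  have min: "min (Suc (nth_state w i)) w = min (Suc i) w" for i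
    using nth_state[OF assms(1), of i] by (auto simp: min_def split: if_splits)
  have sat: "sat \<gamma> t (F (min (Suc i) w)) (window_sel w (nth_state w i)) \<longleftrightarrow> good i"
    "sat \<gamma> t (Neg (F (min (Suc i) w))) (window_sel w (nth_state w i)) \<longleftrightarrow> \<not> good i"
    if "remembers w S i \<gamma>" "event_at S i = Some t" for i \<gamma> t
    using sat_window_sel[OF assms(1) that] F[of "min (Suc i) w"] assms(1) by (auto simp: good_def)
  \<comment> \<open>Nothing is claimed in the final state: \<open>hit\<close> does not store its
    event, and no step continues from there.\<close>
  have inv: "\<exists>i q \<gamma>. c = (i, q, \<gamma>) \<and> (q < 2 * w \<longrightarrow> q = nth_state w i \<and> remembers w S i \<gamma>)"
    if "reaches ?W S (0, 0, \<lambda>_. None) c" for c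
    using that
  proof (induction rule: rtranclp_induct)
    case base
    then show ?case by (auto simp: remembers_def)
  next
    case (step c c')
    then obtain \<delta> i q \<gamma> where s: "successor ?W S c \<delta> c'" and c: "c = (i, q, \<gamma>)"
      and q: "q < 2 * w \<longrightarrow> q = nth_state w i \<and> remembers w S i \<gamma>" by blast
    from s show ?case
    proof cases
      case (read q' f rs p R z i' t \<gamma>')
      then have "q < 2 * w" using c by (auto simp: window_rma_def hit_def miss_def)
      then have "q = nth_state w i" "remembers w S i \<gamma>" using q by auto
      moreover have "q mod w = i mod w"
        using nth_state[OF assms(1)] \<open>q = nth_state w i\<close> by blast
      ultimately show ?thesis
        using read c remembers_step[of w S i \<gamma> t] by (auto simp: window_rma_def hit_def miss_def)
    qed (auto simp: window_rma_def hit_def miss_def)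
  qed
  have "?L \<longleftrightarrow> (\<exists>c \<delta> c'. reaches ?W S (0, 0, \<lambda>_. None) c \<and> successor ?W S c \<delta> c' \<and>
       fst (snd c') \<in> finals ?W \<and> out \<delta> = Mark)"
    by (rule accepting_run_iff) (auto simp: window_rma_def hit_def miss_def)
  also have "\<dots> \<longleftrightarrow> (\<exists>i. event_at S i \<noteq> None \<and> good i)"
  proof
    assume "\<exists>c \<delta> c'. reaches ?W S (0, 0, \<lambda>_. None) c \<and> successor ?W S c \<delta> c' \<and>
       fst (snd c') \<in> finals ?W \<and> out \<delta> = Mark"
    then obtain c \<delta> c' where r: "reaches ?W S (0, 0, \<lambda>_. None) c" and s: "successor ?W S c \<delta> c'"
      and out: "out \<delta> = Mark" by blast
    have "\<delta> \<in> hit w F ` {..<2 * w}"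
      using successor_trans[OF s] out by (auto simp: window_rma_def miss_def)
    then obtain q where q: "q < 2 * w" "\<delta> = hit w F q" by auto
    with s obtain i \<gamma> t where c: "c = (i, q, \<gamma>)" and t: "event_at S i = Some t"
      and f: "sat \<gamma> t (F (min (Suc q) w)) (window_sel w q)"
      by (auto simp: hit_def elim: successor.cases)
    have "q = nth_state w i" "remembers w S i \<gamma>" using inv[OF r] c q(1) by auto
    then have "good i" using f t sat min by auto
    with t show "\<exists>i. event_at S i \<noteq> None \<and> good i" by auto
  next
    assume "\<exists>i. event_at S i \<noteq> None \<and> good i"
    \<comment> \<open>The least good index is taken so that every earlier event enables
      \<open>miss\<close>; a good one would disable it.\<close>
    then obtain i where i: "event_at S i \<noteq> None" "good i" and least: "\<And>j. j < i \<Longrightarrow> \<not> good j"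
      using event_at_down exists_least_iff[of "\<lambda>i. event_at S i \<noteq> None \<and> good i"]
      by (metis less_imp_le)
    have "\<exists>\<gamma>. reaches ?W S (0, 0, \<lambda>_. None) (j, nth_state w j, \<gamma>) \<and> remembers w S j \<gamma>"
      if "j \<le> i" for j
      using that
    proof (induction j)
      case 0
      show ?case by (intro exI[of _ "\<lambda>_. None"]) (auto simp: remembers_def)
    next
      case (Suc j)
      then obtain \<gamma> where \<gamma>: "reaches ?W S (0, 0, \<lambda>_. None) (j, nth_state w j, \<gamma>)"
        "remembers w S j \<gamma>" by auto
      obtain t where t: "event_at S j = Some t" using event_at_down[OF i(1), of j] Suc.prems by auto
      have "successor ?W S (j, nth_state w j, \<gamma>) (miss w F (nth_state w j))
          (Suc j, next_state w (nth_state w j),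
           \<lambda>r. if r \<in> {nth_state w j mod w} then Some t else \<gamma> r)"
        unfolding miss_def
        using sat(2)[OF \<gamma>(2) t] least[of j] Suc.prems lt[of j] t min[of j]
        by (intro successor.read) (auto simp: window_rma_def miss_def)
      then have "reaches ?W S (0, 0, \<lambda>_. None) (Suc j, nth_state w (Suc j),
           \<lambda>r. if r \<in> {j mod w} then Some t else \<gamma> r)"
        using \<gamma>(1) nth_state[OF assms(1), of j] by (auto intro: rtranclp.rtrancl_into_rtrancl)
      with remembers_step[OF \<gamma>(2) t] show ?case by blast
    qed
    then obtain \<gamma> where \<gamma>: "reaches ?W S (0, 0, \<lambda>_. None) (i, nth_state w i, \<gamma>)"
      "remembers w S i \<gamma>" by blast
    obtain t where t: "event_at S i = Some t" using i(1) by auto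
    have "successor ?W S (i, nth_state w i, \<gamma>) (hit w F (nth_state w i))
        (Suc i, 2 * w, \<lambda>r. if r \<in> {} then Some t else \<gamma> r)"
      unfolding hit_def using sat(1)[OF \<gamma>(2) t] i(2) lt[of i] t min[of i]
      by (intro successor.read) (auto simp: window_rma_def hit_def)
    with \<gamma>(1) show "\<exists>c \<delta> c'. reaches ?W S (0, 0, \<lambda>_. None) c \<and> successor ?W S c \<delta> c' \<and>
       fst (snd c') \<in> finals ?W \<and> out \<delta> = Mark"
      by (intro exI conjI) (auto simp: hit_def window_rma_def)
  qed
  finally show ?thesis by (simp add: good_def)
qed

section \<open>Determinization\<close>

lemma unroll_determinizable:
  assumes preds: "true_pred \<in> preds" and w: "0 < w" and fin: "finite (trans A)"
    and A: "\<And>\<delta>. \<delta> \<in> trans A \<Longrightarrow> is_Read \<delta> \<and> selective preds \<delta>"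
  shows "output_agnostic_determinizable preds (add_self_loop [] (unroll A q w))"
proof -
  define N where "N = {\<pi> \<in> nodes A q w. \<pi> \<noteq> [] \<and> tgt (hd \<pi>) \<in> finals A \<and> out (hd \<pi>) = Mark}"
  \<comment> \<open>Paths count positions forward from the root, windows backward from the current
    event; \<open>length \<pi> - Suc j\<close> converts one into the other. The bound
    \<open>m\<close> excludes paths longer than the available events.\<close>
  define P where "P m \<sigma> \<longleftrightarrow> (\<exists>\<pi>\<in>{\<pi> \<in> N. length \<pi> \<le> m}. fits (\<lambda>j. \<sigma> (length \<pi> - Suc j)) \<pi>)" for m \<sigma>
  have def_fits: "definable preds (length \<pi>) (\<lambda>s. fits s \<pi>)" if "\<pi> \<in> N" for \<pi>
    using that A preds by (intro definable_fits) (auto simp: N_def dest: nodes_trans)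
  have "definable preds m (P m)" if "0 < m" for m
    unfolding P_def
  proof (rule definable_bex[OF preds that])
    show "finite {\<pi> \<in> N. length \<pi> \<le> m}" using finite_nodes[OF fin] by (simp add: N_def)
    show "definable preds m (\<lambda>\<sigma>. fits (\<lambda>j. \<sigma> (length \<pi> - Suc j)) \<pi>)"
      if "\<pi> \<in> {\<pi> \<in> N. length \<pi> \<le> m}" for \<pi>
      using that by (intro definable_subst[OF def_fits]) auto
  qed
  \<comment> \<open>The premise on \<open>m\<close> stands inside the existential quantifier so that
    a formula can be chosen for every \<open>m\<close>.\<close>
  then have "\<exists>f. 0 < m \<longrightarrow> selection_formula preds f \<and> fvar f = {..<m} \<and> (\<forall>\<sigma>. holds \<sigma> f \<longleftrightarrow> P m \<sigma>)"
    for m by (metis definable_full[OF preds])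
  then obtain F where F: "\<And>m. 0 < m \<Longrightarrow> selection_formula preds (F m) \<and> fvar (F m) = {..<m}"
    "\<And>m \<sigma>. 0 < m \<Longrightarrow> holds \<sigma> (F m) \<longleftrightarrow> P m \<sigma>"
    by metis
  \<comment> \<open>The two event sequences need to agree only at positions below
    \<open>length \<pi>\<close>, since \<open>fits\<close> is definable from these; beyond them,
    truncated subtraction may make them differ.\<close>
  have shift: "fits (\<lambda>j. events_until S i (length \<pi> - Suc j)) \<pi> \<longleftrightarrow>
      fits (events_from S (Suc i - length \<pi>)) \<pi>" if "\<pi> \<in> N" "length \<pi> \<le> Suc i" for S i \<pi>
  proof (rule definable_cong[OF def_fits[OF that(1)]])
    fix j assume "j < length \<pi>"
    then have "i - (length \<pi> - Suc j) = Suc i - length \<pi> + j" using that(2) by simp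
    then show "events_until S i (length \<pi> - Suc j) = events_from S (Suc i - length \<pi>) j" by simp
  qed
  have "(\<exists>cs \<delta>s. accepting_run (add_self_loop [] (unroll A q w)) S cs \<delta>s) \<longleftrightarrow>
      (\<exists>cs \<delta>s. accepting_run (window_rma w F) S cs \<delta>s)" for S
  proof -
    have "(\<exists>cs \<delta>s. accepting_run (window_rma w F) S cs \<delta>s) \<longleftrightarrow>
        (\<exists>i. event_at S i \<noteq> None \<and> P (min (Suc i) w) (events_until S i))"
      using window_rma_accepts_iff[OF w, of F S] F w by auto
    also have "\<dots> \<longleftrightarrow> (\<exists>n \<delta> \<pi>. \<delta> # \<pi> \<in> N \<and> event_at S (n + length \<pi>) \<noteq> None \<and>
        fits (events_from S n) (\<delta> # \<pi>))" (is "?L \<longleftrightarrow> ?R")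
    proof
      assume ?L
      then obtain i \<pi> where i: "event_at S i \<noteq> None" "\<pi> \<in> N" "length \<pi> \<le> Suc i"
        "fits (\<lambda>j. events_until S i (length \<pi> - Suc j)) \<pi>" unfolding P_def by auto
      obtain \<delta> \<pi>' where \<pi>: "\<pi> = \<delta> # \<pi>'" using i(2) by (cases \<pi>) (auto simp: N_def)
      have "fits (events_from S (Suc i - length \<pi>)) \<pi>" using i shift by blast
      moreover have "Suc i - length \<pi> + length \<pi>' = i" using i(3) \<pi> by simp
      ultimately show ?R using i(1,2) \<pi> by metis
    next
      assume ?R
      then obtain n \<delta> \<pi> where n: "\<delta> # \<pi> \<in> N" "event_at S (n + length \<pi>) \<noteq> None"
        "fits (events_from S n) (\<delta> # \<pi>)" by blast
      let ?i = "n + length \<pi>"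
      have "Suc ?i - length (\<delta> # \<pi>) = n" by simp
      then have "fits (\<lambda>j. events_until S ?i (length (\<delta> # \<pi>) - Suc j)) (\<delta> # \<pi>)"
        using shift[OF n(1), of ?i S] n(3) by (simp del: fits.simps)
      \<comment> \<open>The bound by \<open>w\<close> is the depth of the tree.\<close>
      moreover have "length (\<delta> # \<pi>) \<le> min (Suc ?i) w"
        using n(1) by (auto simp: N_def dest: nodes_trans)
      ultimately have "P (min (Suc ?i) w) (events_until S ?i)"
        unfolding P_def using n(1) by blast
      with n(2) show ?L by blast
    qed
    also have "\<dots> \<longleftrightarrow> (\<exists>cs \<delta>s. accepting_run (add_self_loop [] (unroll A q w)) S cs \<delta>s)"
      unfolding urma_accepts_iff N_def by auto
    finally show ?thesis by simp
  qed
  moreover have "is_rma preds (window_rma w F)" using w F by (intro window_rma_is_rma) auto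
  ultimately show ?thesis
    using window_rma_deterministic unfolding output_agnostic_determinizable_def by blast
qed

section \<open>Finiteness and selection formulas along the construction\<close>

lemma selective_map_transition: "selective preds (map_transition h \<delta>) \<longleftrightarrow> selective preds \<delta>"
  by (cases \<delta>) (auto simp: selective_def)

lemma selective_Eps: "selective preds (Eps q p)"
  by (simp add: selective_def)

lemma set_var_occs: "set (var_occs f) = fvar f"
  by (induction f) auto

lemma position_less: "x \<in> set xs \<Longrightarrow> position xs x < length xs"
  unfolding position_def by (induction xs) auto

text \<open>The arguments of \<open>f\<close> are appended to the selection, and
  \<open>position\<close> sends each variable of \<open>f\<close> to an index within this appended
  part.\<close>

lemma selective_filter_trans:
  assumes "selective preds \<delta>" "selection_formula preds f"
  shows "selective preds (filter_trans f A x \<delta>)"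
proof (cases \<delta>)
  case (Read q g rs p R z)
  have "position (remdups (var_occs f)) y < length (remdups (var_occs f))" if "y \<in> fvar f" for y
    using that by (intro position_less) (simp add: set_var_occs)
  then show ?thesis
    using assms Read
    by (auto simp: selective_def Let_def selection_formula_map_formula formula.set_map)
qed (simp add: selective_Eps)

lemma rma_of_wf:
  assumes "predicate_set type_of preds" "core_cepl preds \<psi>"
  shows "finite (lstates (rma_of type_of \<psi>)) \<and> finite (ltrans (rma_of type_of \<psi>)) \<and>
    (\<forall>(l, \<delta>)\<in>ltrans (rma_of type_of \<psi>). selective preds \<delta>)"
  using assms(2)
proof (induction \<psi>)
  case (As R x)
  then show ?case using assms(1)
    by (auto simp: as_rma_def selective_def predicate_set_def true_fml_def true_pred_def type_pred_def)
next
  case (Filter \<psi> f)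
  then show ?case
    by (auto simp: filter_rma_def intro!: selective_filter_trans split: option.splits)
next
  case (Or \<phi>1 \<phi>2)
  then show ?case
    by (auto simp: or_rma_def tag_def Let_def selective_map_transition selective_Eps)
next
  case (Seq \<phi>1 \<phi>2)
  then show ?case
    by (auto simp: seq_rma_def tag_def Let_def selective_map_transition selective_Eps)
next
  case (Plus \<psi>)
  then show ?case
    by (auto simp: plus_rma_def selective_Eps)
qed

lemma eps_free_is_Read: "\<delta> \<in> trans (eps_free A) \<Longrightarrow> is_Read \<delta>"
  by (auto simp: eps_free_def)

lemma eps_free_selective:
  assumes "\<delta> \<in> trans (eps_free A)" "\<And>\<epsilon>. \<epsilon> \<in> trans A \<Longrightarrow> selective preds \<epsilon>"
  shows "selective preds \<delta>"
  using assms by (fastforce simp: eps_free_def selective_def)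

text \<open>A new transition is determined by its source and the original transition it copies, so
  there are at most as many as pairs of a state and a transition.\<close>

lemma finite_trans_eps_free:
  assumes "finite (states A)" "finite (trans A)"
  shows "finite (trans (eps_free A))"
proof (rule finite_subset)
  show "trans (eps_free A) \<subseteq> (\<lambda>(q, \<delta>). Read q (fml \<delta>) (sel \<delta>) (tgt \<delta>) (writes \<delta>) (out \<delta>)) `
      (states A \<times> trans A)"
    by (force simp: eps_free_def)
qed (use assms in simp)

theorem corollary16:
  fixes type_of :: "'e \<Rightarrow> 'r::finite"
    and preds :: "'e predicate set"
    and \<phi> :: "('r, 'e, 'v) windowed_cepl"
    and \<psi> :: "('r, 'e, 'v) cepl"
    and w :: nat
  assumes "predicate_set type_of preds"
    and "\<phi> = \<psi> WINDOW w"
    and "bounded_windowed preds \<phi>"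
  shows "output_agnostic_determinizable preds (urma type_of \<phi>)"
proof -
  let ?A = "underlying (rma_of type_of \<psi>)"
  have core: "core_cepl preds \<psi>" and w: "0 < w" using assms(2,3) by auto
  have wf: "finite (states ?A)" "finite (trans ?A)" "\<And>\<delta>. \<delta> \<in> trans ?A \<Longrightarrow> selective preds \<delta>"
    using rma_of_wf[OF assms(1) core] by (auto simp: underlying_def)
  have "true_pred \<in> preds" using assms(1) by (simp add: predicate_set_def)
  then have "output_agnostic_determinizable preds
      (add_self_loop [] (unroll (eps_free ?A) (lstart (rma_of type_of \<psi>)) w))"
    using w wf
    by (intro unroll_determinizable finite_trans_eps_free conjI)
       (auto intro: eps_free_is_Read eps_free_selective)
  then show ?thesis using assms(2) by (simp add: Let_def)
qed

end
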